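(* Every set of pairwise orthogonal pure stabilizer states $\{|\psi_i\rangle\}_{i=0}^{n-1}$ in $\mathcal{H}_d$ can be unambiguously distinguished via PWF POVMs.
   Context: $\mathcal{H}_d$ is a Hilbert space of odd dimension $d\ge 3$; if $d$ is not prime, $\mathcal{H}_d$ is understood as a given tensor product of Hilbert spaces each of odd prime dimension. Phase-space operators. For $d$ an odd prime with computational basis $\{|j\rangle\}_{j\in\mathbb{Z}_d}$, let $X|j\rangle=|j+1 \bmod d\rangle$, $Z|j\rangle=e^{2\pi i j/d}|j\rangle$. For $\mathbf{u}=(a_1,a_2)\in\mathbb{Z}_d\times\mathbb{Z}_d$ let $T_{\mathbf{u}}=e^{-(d+1)\pi i a_1a_2/d}Z^{a_1}X^{a_2}$, $A_{\mathbf{0}}=\frac1d\sum_{\mathbf{u}}T_{\mathbf{u}}$, $A_{\mathbf{u}}=T_{\mathbf{u}}A_{\mathbf{0}}T_{\mathbf{u}}^\dagger$. For a tensor product of odd-prime-dimensional systems, the phase space is the product of the individual phase spaces, and $T_{\mathbf{u}}$ and $A_{\mathbf{u}}$ are the tensor products of the corresponding single-system operators. PWF POVMs. A POVM effect $E$ has discrete Wigner function $W(E|\mathbf{u})=\operatorname{Tr}[EA_{\mathbf{u}}]$ and is PWF if $W(E|\mathbf{u})\ge0$ for all $\mathbf{u}$. A PWF POVM is a finite POVM all of whose effects are PWF. Stabilizer states. A unit vector $|\psi\rangle$ is a pure stabilizer state if $|\psi\rangle\langle\psi|=\frac{1}{|G|}\sum_{g\in G} g$ for some finite abelian group $G$ of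 unitaries, each a unit-modulus scalar multiple of some $T_{\mathbf{u}}$, containing no scalar operator other than the identity (so $|G|=d$). Unambiguous discrimination. A set of states $\{\sigma_0,\dots,\sigma_{n-1}\}$ can be unambiguously distinguished via PWF POVMs if there is a PWF POVM $\{E_0,\dots,E_{n-1},E_n\}$ (with $E_n$, the inconclusive outcome, possibly zero) such that $\operatorname{Tr}(E_i\sigma_j)=0$ for all $i\ne j$ in $\{0,\dots,n-1\}$ and $\operatorname{Tr}(E_i\sigma_i)>0$ for all $i\in\{0,\dots,n-1\}$. *)

theory Defs
  imports
    "Jordan_Normal_Form.Schur_Decomposition"
    "HOL-Computational_Algebra.Primes"
begin

text \<open>
  Operators on a \<open>d\<close>-dimensional Hilbert space with a fixed computational basis are complex
  \<open>d \<times> d\<close> matrices. The order on complex numbers is the one of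
  \<open>HOL-Library.Complex_Order\<close>: \<open>0 \<le> z\<close> says that \<open>z\<close> is real and nonnegative.
\<close>

definition mat_trace :: "complex mat \<Rightarrow> complex" where
  "mat_trace A = (\<Sum>i<dim_row A. A $$ (i, i))"

text \<open>The type of matrices carries no \<open>comm_monoid_add\<close> structure, so sums are taken entrywise.\<close>

definition mat_sum :: "nat \<Rightarrow> ('i \<Rightarrow> complex mat) \<Rightarrow> 'i set \<Rightarrow> complex mat" where
  "mat_sum d f I = mat d d (\<lambda>(i, j). \<Sum>k\<in>I. f k $$ (i, j))"

definition unitary_mat :: "nat \<Rightarrow> complex mat \<Rightarrow> bool" where
  "unitary_mat d U \<longleftrightarrow> U \<in> carrier_mat d d \<and>
     mat_adjoint U * U = 1\<^sub>m d \<and> U * mat_adjoint U = 1\<^sub>m d"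

definition psd_mat :: "nat \<Rightarrow> complex mat \<Rightarrow> bool" where
  "psd_mat d A \<longleftrightarrow> A \<in> carrier_mat d d \<and> mat_adjoint A = A \<and>
     (\<forall>v \<in> carrier_vec d. 0 \<le> (A *\<^sub>v v) \<bullet>c v)"

definition proj :: "complex vec \<Rightarrow> complex mat" where
  "proj \<psi> = mat (dim_vec \<psi>) (dim_vec \<psi>) (\<lambda>(i, j). \<psi> $ i * cnj (\<psi> $ j))"

text \<open>Kronecker product; the left factor is the more significant one in the basis ordering.\<close>

definition kron :: "complex mat \<Rightarrow> complex mat \<Rightarrow> complex mat" where
  "kron A B = mat (dim_row A * dim_row B) (dim_col A * dim_col B)
     (\<lambda>(i, j). A $$ (i div dim_row B, j div dim_col B) * B $$ (i mod dim_row B, j mod dim_col B))"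

definition tensor :: "complex mat list \<Rightarrow> complex mat" where
  "tensor As = foldr kron As (1\<^sub>m 1)"

text \<open>Elements of \<open>\<int>/p\<int>\<close> are represented by the natural numbers below \<open>p\<close>. Since \<open>p\<close> is
  odd, the phase in \<open>displacement1\<close> depends on \<open>a1\<close> and \<open>a2\<close> modulo \<open>p\<close> only.\<close>

definition shift_op :: "nat \<Rightarrow> complex mat" where
  "shift_op p = mat p p (\<lambda>(i, j). if i = (j + 1) mod p then 1 else 0)"

definition clock_op :: "nat \<Rightarrow> complex mat" where
  "clock_op p = mat p p (\<lambda>(i, j). if i = j then cis (2 * pi * real j / real p) else 0)"

definition displacement1 :: "nat \<Rightarrow> nat \<times> nat \<Rightarrow> complex mat" where
  "displacement1 p u = (case u of (a1, a2) \<Rightarrow>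
     cis (- (real ((p + 1) * a1 * a2) * pi / real p)) \<cdot>\<^sub>m
       ((clock_op p ^\<^sub>m a1) * (shift_op p ^\<^sub>m a2)))"

definition phase_point0 :: "nat \<Rightarrow> complex mat" where
  "phase_point0 p = (1 / of_nat p) \<cdot>\<^sub>m mat_sum p (displacement1 p) ({..<p} \<times> {..<p})"

definition phase_point1 :: "nat \<Rightarrow> nat \<times> nat \<Rightarrow> complex mat" where
  "phase_point1 p u = displacement1 p u * phase_point0 p * mat_adjoint (displacement1 p u)"

text \<open>
  A list \<open>ps\<close> of odd primes stands for the Hilbert space of dimension \<open>prod_list ps\<close> with the
  given decomposition into tensor factors of dimensions \<open>ps ! 0\<close>, \<open>ps ! 1\<close>, and so on.
\<close>

definition phase_space :: "nat list \<Rightarrow> (nat \<times> nat) list set" where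
  "phase_space ps = {us. list_all2 (\<lambda>p u. u \<in> {..<p} \<times> {..<p}) ps us}"

definition displacement :: "nat list \<Rightarrow> (nat \<times> nat) list \<Rightarrow> complex mat" where
  "displacement ps us = tensor (map2 displacement1 ps us)"

definition phase_point :: "nat list \<Rightarrow> (nat \<times> nat) list \<Rightarrow> complex mat" where
  "phase_point ps us = tensor (map2 phase_point1 ps us)"

definition wigner :: "nat list \<Rightarrow> complex mat \<Rightarrow> (nat \<times> nat) list \<Rightarrow> complex" where
  "wigner ps E u = mat_trace (E * phase_point ps u)"

definition pwf :: "nat list \<Rightarrow> complex mat \<Rightarrow> bool" where
  "pwf ps E \<longleftrightarrow> (\<forall>u \<in> phase_space ps. 0 \<le> wigner ps E u)"

definition povm :: "nat \<Rightarrow> nat \<Rightarrow> (nat \<Rightarrow> complex mat) \<Rightarrow> bool" where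
  "povm d m E \<longleftrightarrow> (\<forall>i<m. psd_mat d (E i)) \<and> mat_sum d E {..<m} = 1\<^sub>m d"

definition pwf_povm :: "nat list \<Rightarrow> nat \<Rightarrow> (nat \<Rightarrow> complex mat) \<Rightarrow> bool" where
  "pwf_povm ps m E \<longleftrightarrow> povm (prod_list ps) m E \<and> (\<forall>i<m. pwf ps (E i))"

definition pure_stabilizer_state :: "nat list \<Rightarrow> complex vec \<Rightarrow> bool" where
  "pure_stabilizer_state ps \<psi> \<longleftrightarrow>
     (let d = prod_list ps in
        \<psi> \<in> carrier_vec d \<and> \<psi> \<bullet>c \<psi> = 1 \<and>
        (\<exists>G. finite G \<and>
             comm_group \<lparr>carrier = G, monoid.mult = (*), one = 1\<^sub>m d\<rparr> \<and>
             (\<forall>g \<in> G. unitary_mat d g \<and>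
                (\<exists>c. \<exists>u \<in> phase_space ps. cmod c = 1 \<and> g = c \<cdot>\<^sub>m displacement ps u)) \<and>
             (\<forall>c. c \<cdot>\<^sub>m 1\<^sub>m d \<in> G \<longrightarrow> c \<cdot>\<^sub>m 1\<^sub>m d = 1\<^sub>m d) \<and>
             proj \<psi> = (1 / of_nat (card G)) \<cdot>\<^sub>m mat_sum d (\<lambda>g. g) G))"

text \<open>The effect \<open>E n\<close> is the inconclusive outcome.\<close>

definition unambiguously_distinguishable_pwf ::
    "nat list \<Rightarrow> nat \<Rightarrow> (nat \<Rightarrow> complex mat) \<Rightarrow> bool" where
  "unambiguously_distinguishable_pwf ps n \<sigma> \<longleftrightarrow>
     (\<exists>E. pwf_povm ps (n + 1) E \<and>
          (\<forall>i<n. \<forall>j<n. i \<noteq> j \<longrightarrow> mat_trace (E i * \<sigma> j) = 0) \<and>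
          (\<forall>i<n. 0 < mat_trace (E i * \<sigma> i)))"

end

theory Submission
  imports Defs "HOL-Analysis.L2_Norm"
begin

text \<open>
  For a pure stabilizer state the discrete Wigner function only takes the values 0 and 1: the
  projector is the average of a group \<open>G\<close> of multiples of displacement operators, and commutativity
  of \<open>G\<close> turns \<open>g \<mapsto> Tr (g A\<^sub>u)\<close> into a character of \<open>G\<close>. As \<open>Tr A\<^sub>u = 1\<close>, the effects
  \<open>E\<^sub>i = |\<psi>\<^sub>i\<rangle>\<langle>\<psi>\<^sub>i| / (n + 1)\<close>, completed by \<open>1 - (\<Sum>i<n. E\<^sub>i)\<close>, therefore form a PWF POVM, and
  by orthogonality \<open>Tr (E\<^sub>i |\<psi>\<^sub>j\<rangle>\<langle>\<psi>\<^sub>j|) = 0\<close> for \<open>i \<noteq> j\<close>.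
\<close>

subsection \<open>Traces, sums and Kronecker products of matrices\<close>

lemma index_mult_mat_sum:
  assumes "A \<in> carrier_mat m k" "B \<in> carrier_mat k n" "i < m" "j < n"
  shows "(A * B) $$ (i, j) = (\<Sum>l<k. A $$ (i, l) * B $$ (l, j))"
  using assms by (auto simp: scalar_prod_def lessThan_atLeast0 intro!: sum.cong)

lemma mat_adjoint_carrier [intro]:
  "A \<in> carrier_mat m n \<Longrightarrow> mat_adjoint A \<in> carrier_mat n m"
  by (auto simp: mat_adjoint_def mat_of_rows_def)

lemma index_mat_adjoint:
  assumes "A \<in> carrier_mat m n" "i < n" "j < m"
  shows "mat_adjoint A $$ (i, j) = cnj (A $$ (j, i))"
  using assms by (auto simp: mat_adjoint_def mat_of_rows_def)

lemma mat_trace_mult: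
  assumes "A \<in> carrier_mat m n" "B \<in> carrier_mat n m"
  shows "mat_trace (A * B) = (\<Sum>i<m. \<Sum>j<n. A $$ (i, j) * B $$ (j, i))"
  using assms by (auto simp: mat_trace_def index_mult_mat_sum simp del: index_mult_mat(1) intro!: sum.cong)

lemma mat_trace_mult_comm:
  assumes "A \<in> carrier_mat m n" "B \<in> carrier_mat n m"
  shows "mat_trace (A * B) = mat_trace (B * A)"
proof -
  have "mat_trace (A * B) = (\<Sum>i<m. \<Sum>j<n. A $$ (i, j) * B $$ (j, i))"
    using assms by (rule mat_trace_mult)
  also have "\<dots> = (\<Sum>j<n. \<Sum>i<m. B $$ (j, i) * A $$ (i, j))"
    by (subst sum.swap) (simp add: mult.commute)
  also have "\<dots> = mat_trace (B * A)"
    using assms by (simp add: mat_trace_mult)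
  finally show ?thesis .
qed

lemma smult_smult_mat: "a \<cdot>\<^sub>m (b \<cdot>\<^sub>m A) = (a * b) \<cdot>\<^sub>m A" for A :: "'a :: semigroup_mult mat"
  by (rule eq_matI) (auto simp: mult.assoc)

lemma one_smult_mat: "1 \<cdot>\<^sub>m A = A" for A :: "'a :: monoid_mult mat"
  by (rule eq_matI) auto

lemma mat_trace_smult: "mat_trace (c \<cdot>\<^sub>m A) = c * mat_trace A" if "A \<in> carrier_mat n n"
  using that by (auto simp: mat_trace_def sum_distrib_left intro!: sum.cong)

lemma mat_trace_smult_mult:
  assumes "A \<in> carrier_mat n n" "B \<in> carrier_mat n n"
  shows "mat_trace ((c \<cdot>\<^sub>m A) * B) = c * mat_trace (A * B)"
  using assms by (subst mult_smult_assoc_mat[of _ n n _ n]) (auto intro!: mat_trace_smult)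

lemma mat_sum_carrier [simp, intro]: "mat_sum d f I \<in> carrier_mat d d"
  by (simp add: mat_sum_def)

lemma mat_trace_mat_sum_mult:
  assumes "B \<in> carrier_mat d d" "\<And>k. k \<in> I \<Longrightarrow> f k \<in> carrier_mat d d"
  shows "mat_trace (mat_sum d f I * B) = (\<Sum>k\<in>I. mat_trace (f k * B))"
proof -
  have "mat_trace (mat_sum d f I * B) = (\<Sum>i<d. \<Sum>j<d. \<Sum>k\<in>I. f k $$ (i, j) * B $$ (j, i))"
    using assms(1) by (subst mat_trace_mult[of _ d d]) (auto simp: mat_sum_def sum_distrib_right)
  also have "\<dots> = (\<Sum>i<d. \<Sum>k\<in>I. \<Sum>j<d. f k $$ (i, j) * B $$ (j, i))"
    by (intro sum.cong refl sum.swap)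
  also have "\<dots> = (\<Sum>k\<in>I. \<Sum>i<d. \<Sum>j<d. f k $$ (i, j) * B $$ (j, i))"
    by (rule sum.swap)
  also have "\<dots> = (\<Sum>k\<in>I. mat_trace (f k * B))"
    using assms by (intro sum.cong) (simp_all add: mat_trace_mult[of _ d d])
  finally show ?thesis .
qed

section \<open>Kronecker products: traces and multiplication\<close>

lemma kron_carrier [intro]:
  assumes "A \<in> carrier_mat m n" "B \<in> carrier_mat k l"
  shows "kron A B \<in> carrier_mat (m * k) (n * l)"
  using assms by (auto simp: kron_def)

text \<open>Cutting the range into m blocks of length n, block i consists of the indices with
  quotient i, and the remainder runs through all of {..<n}. Sums over Kronecker indices become
  double sums in this way.\<close>

lemma sum_div_mod:
  fixes f :: "nat \<Rightarrow> nat \<Rightarrow> 'a :: comm_monoid_add"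
  shows "(\<Sum>i<m * n. f (i div n) (i mod n)) = (\<Sum>i<m. \<Sum>j<n. f i j)"
proof -
  have "(\<Sum>j=i * n..<i * n + n. f (j div n) (j mod n)) = (\<Sum>j<n. f i j)" for i
  proof -
    have div: "j div n = i" if "i * n \<le> j" "j < i * n + n" for j
      using that by (intro div_nat_eqI) (simp_all add: mult.commute)
    then have "j mod n = j - i * n" if "i * n \<le> j" "j < i * n + n" for j
      using that by (simp add: modulo_nat_def)
    with div show ?thesis
      by (intro sum.reindex_bij_witness[of _ "\<lambda>j. i * n + j" "\<lambda>j. j - i * n"]) auto
  qed
  then show ?thesis
    by (simp flip: sum.nat_group)
qed

lemma div_mod_less:
  fixes i m n :: nat
  assumes "i < m * n"
  shows "i div n < m" "i mod n < n"
  using assms by (auto simp: less_mult_imp_div_less intro!: mod_less_divisor gr0I)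

lemma mat_trace_kron:
  assumes "A \<in> carrier_mat m m" "B \<in> carrier_mat n n"
  shows "mat_trace (kron A B) = mat_trace A * mat_trace B"
proof -
  have "mat_trace (kron A B) = (\<Sum>i<m * n. A $$ (i div n, i div n) * B $$ (i mod n, i mod n))"
    using assms by (auto simp: mat_trace_def kron_def)
  also have "\<dots> = mat_trace A * mat_trace B"
    using assms by (subst sum_div_mod) (auto simp: mat_trace_def sum_product)
  finally show ?thesis .
qed

text \<open>Mixed-product rule: the inner summation index splits into quotient and remainder, and
  the resulting double sum factors into the entries of \<open>A * C\<close> and
  \<open>B * D\<close>.\<close>

lemma kron_mult:
  assumes "A \<in> carrier_mat m m" "B \<in> carrier_mat n n" "C \<in> carrier_mat m m" "D \<in> carrier_mat n n"
  shows "kron A B * kron C D = kron (A * C) (B * D)"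
proof (rule eq_matI)
  fix i j assume "i < dim_row (kron (A * C) (B * D))" "j < dim_col (kron (A * C) (B * D))"
  then have i: "i < m * n" and j: "j < m * n"
    using assms by (auto simp: kron_def)
  note less = div_mod_less[OF i] div_mod_less[OF j]
  have "(kron A B * kron C D) $$ (i, j) = (\<Sum>k<m * n. kron A B $$ (i, k) * kron C D $$ (k, j))"
    using assms i j by (intro index_mult_mat_sum[of _ "m * n" _ _ "m * n"] kron_carrier) auto
  also have "\<dots> = (\<Sum>k<m * n. (A $$ (i div n, k div n) * B $$ (i mod n, k mod n)) *
      (C $$ (k div n, j div n) * D $$ (k mod n, j mod n)))"
    using assms i j by (auto simp: kron_def)
  also have "\<dots> = (\<Sum>k<m. \<Sum>l<n. (A $$ (i div n, k) * B $$ (i mod n, l)) *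
      (C $$ (k, j div n) * D $$ (l, j mod n)))"
    by (rule sum_div_mod)
  also have "\<dots> = (\<Sum>k<m. A $$ (i div n, k) * C $$ (k, j div n)) *
      (\<Sum>l<n. B $$ (i mod n, l) * D $$ (l, j mod n))"
    by (simp add: sum_product mult_ac)
  also have "\<dots> = (A * C) $$ (i div n, j div n) * (B * D) $$ (i mod n, j mod n)"
    using index_mult_mat_sum[OF assms(1,3) less(1,3)] index_mult_mat_sum[OF assms(2,4) less(2,4)]
    by simp
  also have "\<dots> = kron (A * C) (B * D) $$ (i, j)"
    using assms i j by (auto simp: kron_def)
  finally show "(kron A B * kron C D) $$ (i, j) = kron (A * C) (B * D) $$ (i, j)" .
qed (use assms in \<open>auto simp: kron_def\<close>)

lemma kron_smult:
  assumes "A \<in> carrier_mat m m" "B \<in> carrier_mat n n"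
  shows "kron (a \<cdot>\<^sub>m A) (b \<cdot>\<^sub>m B) = (a * b) \<cdot>\<^sub>m kron A B"
  using assms by (auto simp: kron_def div_mod_less)

subsection \<open>Displacement and phase-point operators in odd dimension\<close>

text \<open>The additive character of the integers mod p with generator exp(2 pi i / p). Its
  argument is any integer, so phases can be computed by integer algebra and reduced modulo p only at
  the end, by \<open>root_char_cong\<close>.\<close>

definition root_char :: "nat \<Rightarrow> int \<Rightarrow> complex" where
  "root_char p k = cis (2 * pi * of_int k / of_nat p)"

lemma root_char_0 [simp]: "root_char p 0 = 1"
  by (simp add: root_char_def)

lemma root_char_add: "root_char p (k + l) = root_char p k * root_char p l"
  by (simp add: root_char_def cis_mult add_divide_distrib ring_distribs)

lemma cnj_root_char: "cnj (root_char p k) = root_char p (- k)"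
  by (simp add: root_char_def cis_cnj)

lemma root_char_power: "root_char p k ^ n = root_char p (int n * k)"
  by (simp add: root_char_def DeMoivre mult_ac)

lemma root_char_eq_1_iff:
  assumes "p > 0"
  shows "root_char p k = 1 \<longleftrightarrow> int p dvd k"
proof
  assume "root_char p k = 1"
  then have "cos (2 * pi * of_int k / of_nat p) = 1"
    unfolding root_char_def by (metis cis.sel(1) one_complex.sel(1))
  then obtain m :: int where "2 * pi * of_int k / of_nat p = of_int m * 2 * pi"
    using cos_one_2pi_int by blast
  then have "real_of_int k = real_of_int (m * int p)"
    using assms by (simp add: field_simps)
  then have "k = m * int p"
    by linarith
  then show "int p dvd k" by simp
next
  assume "int p dvd k"
  then obtain m where k: "k = int p * m" ..
  have "2 * pi * of_int k / of_nat p = 2 * pi * of_int m"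
    using assms by (simp add: k)
  then show "root_char p k = 1"
    unfolding root_char_def by (simp add: cis_multiple_2pi)
qed

lemma root_char_cong:
  assumes "p > 0" "int p dvd k - l"
  shows "root_char p k = root_char p l"
  using root_char_add[of p "k - l" l] root_char_eq_1_iff[of p "k - l"] assms by simp

text \<open>Orthogonality of characters: this is a geometric sum whose ratio is a p-th root of
  unity, and the ratio is 1 exactly when p divides k.\<close>

lemma sum_root_char:
  assumes "p > 0"
  shows "(\<Sum>i<p. root_char p (k * int i)) = (if int p dvd k then of_nat p else 0)"
proof -
  have eq: "root_char p (k * int i) = root_char p k ^ i" for i
    by (simp add: root_char_power mult.commute)
  have "root_char p k ^ p = 1"
    using assms by (simp add: root_char_power root_char_eq_1_iff)
  then show ?thesis
    using assms root_char_eq_1_iff[OF assms, of k]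
    by (cases "int p dvd k") (simp_all add: eq geometric_sum)
qed

text \<open>The displacement operator with phase-space coordinates in \<open>\<int>\<close> instead of \<open>{..<p}\<close>;
  \<open>(p + 1) div 2\<close> is the inverse of 2 modulo \<open>p\<close>.\<close>

definition weyl :: "nat \<Rightarrow> int \<Rightarrow> int \<Rightarrow> complex mat" where
  "weyl p x y = mat p p (\<lambda>(i, j). if int p dvd int i - int j - y
     then root_char p (x * int i - int ((p + 1) div 2) * x * y) else 0)"

lemma weyl_carrier [simp, intro]: "weyl p x y \<in> carrier_mat p p"
  by (simp add: weyl_def)

text \<open>The congruence that describes the support of \<open>weyl\<close> has exactly one
  solution below p; sums over an index restricted by it collapse to one term.\<close>

lemma dvd_diff_iff_mod:
  assumes "p > 0" "i < p"
  shows "int p dvd int i - k \<longleftrightarrow> i = nat (k mod int p)"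
proof -
  have "int p dvd int i - k \<longleftrightarrow> int i = k mod int p"
    using assms by (metis mod_eq_dvd_iff of_nat_less_iff of_nat_0_le_iff mod_pos_pos_trivial)
  then show ?thesis
    using assms by auto
qed

text \<open>Composition law of the Weyl operators: they multiply like the translations, up to the
  character of half the symplectic form. Every column has a single nonzero entry, so only one
  intermediate index contributes, and the phases are compared modulo p.\<close>

lemma weyl_mult:
  assumes "odd p"
  shows "weyl p x y * weyl p x' y' =
    root_char p (int ((p + 1) div 2) * (x * y' - x' * y)) \<cdot>\<^sub>m weyl p (x + x') (y + y')"
proof (rule eq_matI)
  let ?h = "int ((p + 1) div 2)"
  have p: "p > 0" using assms odd_pos by blast
  have h: "2 * ?h = int p + 1" using assms by (auto elim!: oddE)
  fix i j
  assume "i < dim_row (root_char p (?h * (x * y' - x' * y)) \<cdot>\<^sub>m weyl p (x + x') (y + y'))"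
    "j < dim_col (root_char p (?h * (x * y' - x' * y)) \<cdot>\<^sub>m weyl p (x + x') (y + y'))"
  then have ij: "i < p" "j < p" by (auto simp: weyl_def)
  \<comment> \<open>The only row in which column j of \<open>weyl p x' y'\<close> is
    nonzero.\<close>
  define k where "k = nat ((int j + y') mod int p)"
  have k: "k < p" using p by (simp add: k_def nat_less_iff)
  have kd: "int p dvd int k - (int j + y')"
    using k p dvd_diff_iff_mod k_def by blast
  then obtain q where q: "int k = int j + y' + int p * q"
    by (metis add_diff_cancel_left' dvdE diff_add_cancel add.commute)
  have "(weyl p x y * weyl p x' y') $$ (i, j) = (\<Sum>l<p. weyl p x y $$ (i, l) * weyl p x' y' $$ (l, j))"
    using ij by (intro index_mult_mat_sum) auto
  also have "\<dots> = (\<Sum>l<p. if l = k then weyl p x y $$ (i, l) *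
      root_char p (x' * int l - ?h * x' * y') else 0)"
    using ij p by (intro sum.cong) (auto simp: weyl_def[of p x' y'] k_def dvd_diff_iff_mod diff_diff_eq)
  also have "\<dots> = weyl p x y $$ (i, k) * root_char p (x' * int k - ?h * x' * y')"
    using k by simp
  also have "\<dots> = root_char p (?h * (x * y' - x' * y)) * weyl p (x + x') (y + y') $$ (i, j)"
  proof -
    have iff: "int p dvd int i - int k - y \<longleftrightarrow> int p dvd int i - int j - (y + y')"
    proof -
      have "int i - int k - y = (int i - int j - (y + y')) + int p * (- q)"
        by (simp add: q)
      then show ?thesis
        by (metis dvd_add_left_iff dvd_triv_left)
    qed
    show ?thesis
    proof (cases "int p dvd int i - int k - y")
      case False
      then show ?thesis using ij k iff by (simp add: weyl_def)
    next
      case True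
      then obtain r where r: "int i = int k + y + int p * r"
        by (metis add_diff_cancel_left' dvdE diff_add_cancel add.commute diff_diff_eq)
      have "root_char p (x * int i - ?h * x * y) * root_char p (x' * int k - ?h * x' * y') =
        root_char p ((x * int i - ?h * x * y) + (x' * int k - ?h * x' * y'))"
        by (simp add: root_char_add)
      also have "\<dots> = root_char p (?h * (x * y' - x' * y) +
          ((x + x') * int i - ?h * (x + x') * (y + y')))"
      proof (rule root_char_cong[OF p])
        \<comment> \<open>With i = k + y + p r, the exponents differ by x' y (2h - 1) up to a
          multiple of p, and 2h - 1 = p because h is half of p + 1.\<close>
        have "(x * int i - ?h * x * y) + (x' * int k - ?h * x' * y') - (?h * (x * y' - x' * y) +
          ((x + x') * int i - ?h * (x + x') * (y + y'))) = x' * y * (2 * ?h - 1) - int p * (r * x')"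
          unfolding r by (simp only: ring_distribs) (simp add: algebra_simps)
        also have "\<dots> = int p * (x' * y - r * x')"
          unfolding h by (simp add: algebra_simps)
        finally show "int p dvd (x * int i - ?h * x * y) + (x' * int k - ?h * x' * y') -
          (?h * (x * y' - x' * y) + ((x + x') * int i - ?h * (x + x') * (y + y')))"
          by simp
      qed
      finally show ?thesis
        using ij k iff True by (simp add: weyl_def root_char_add)
    qed
  qed
  finally show "(weyl p x y * weyl p x' y') $$ (i, j) =
    (root_char p (?h * (x * y' - x' * y)) \<cdot>\<^sub>m weyl p (x + x') (y + y')) $$ (i, j)"
    using ij carrier_matD[OF weyl_carrier[of p "x + x'" "y + y'"]] by simp
qed (auto simp: weyl_def)

lemma weyl_0: "p > 0 \<Longrightarrow> weyl p 0 0 = 1\<^sub>m p"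
  by (rule eq_matI) (auto simp: weyl_def dvd_diff_iff_mod)

text \<open>The phase - h x y is chosen symmetrically, with h the inverse of 2 modulo p, so that
  taking the adjoint negates both coordinates and leaves no extra scalar.\<close>

lemma mat_adjoint_weyl:
  assumes "odd p"
  shows "mat_adjoint (weyl p x y) = weyl p (- x) (- y)"
proof (rule eq_matI)
  let ?h = "int ((p + 1) div 2)"
  have p: "p > 0" using assms odd_pos by blast
  have h: "2 * ?h = int p + 1" using assms by (auto elim!: oddE)
  fix i j
  assume "i < dim_row (weyl p (- x) (- y))" "j < dim_col (weyl p (- x) (- y))"
  then have ij: "i < p" "j < p" by (auto simp: weyl_def)
  have adj: "mat_adjoint (weyl p x y) $$ (i, j) = cnj (weyl p x y $$ (j, i))"
    using ij by (intro index_mat_adjoint) auto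
  have "int j - int i - y = - (int i - int j - (- y))"
    by simp
  then have iff: "int p dvd int j - int i - y \<longleftrightarrow> int p dvd int i - int j - (- y)"
    by (metis dvd_minus_iff)
  show "mat_adjoint (weyl p x y) $$ (i, j) = weyl p (- x) (- y) $$ (i, j)"
  proof (cases "int p dvd int j - int i - y")
    case False
    then show ?thesis using ij iff unfolding adj by (simp add: weyl_def)
  next
    case True
    then obtain q where "int j - int i - y = int p * q" ..
    then have q: "int j = int i + y + int p * q" by simp
    have "- (x * int j - ?h * x * y) - (- x * int i - ?h * (- x) * (- y)) =
      x * y * (2 * ?h - 1) - int p * (q * x)"
      unfolding q by (simp only: ring_distribs) (simp add: algebra_simps)
    also have "\<dots> = int p * (x * y - q * x)"
      unfolding h by (simp add: algebra_simps)
    finally have "root_char p (- (x * int j - ?h * x * y)) = root_char p (- x * int i - ?h * (- x) * (- y))"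
      using p by (intro root_char_cong) simp_all
    then show ?thesis
      using ij True iff unfolding adj by (simp add: weyl_def cnj_root_char)
  qed
qed (auto simp: weyl_def mat_adjoint_def mat_of_rows_def)

text \<open>The diagonal vanishes unless p divides y; in that case the trace is a full character sum
  in x.\<close>

lemma mat_trace_weyl:
  assumes "p > 0"
  shows "mat_trace (weyl p x y) = (if int p dvd x \<and> int p dvd y then of_nat p else 0)"
proof (cases "int p dvd y")
  case True
  have "mat_trace (weyl p x y) = (\<Sum>i<p. root_char p (x * int i - int ((p + 1) div 2) * x * y))"
    using True by (auto simp: mat_trace_def weyl_def)
  \<comment> \<open>As p divides y, the term h x y changes the exponent by a multiple of p
    only.\<close>
  also have "\<dots> = (\<Sum>i<p. root_char p (x * int i))"
    using True assms by (intro sum.cong root_char_cong) auto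
  also have "\<dots> = (if int p dvd x \<and> int p dvd y then of_nat p else 0)"
    using True assms by (simp add: sum_root_char)
  finally show ?thesis .
next
  case False
  then show ?thesis by (auto simp: mat_trace_def weyl_def)
qed

section \<open>Identification of the displacement operators with Weyl operators\<close>

lemma clock_op_power: "clock_op p ^\<^sub>m a =
    mat p p (\<lambda>(i, j). if i = j then root_char p (int a * int j) else 0)"
proof (induction a)
  case 0
  show ?case by (auto simp: clock_op_def)
next
  case (Suc a)
  have "(\<Sum>l<p. (if i = l then root_char p (int a * int l) else 0) *
      (if l = j then cis (2 * pi * real j / real p) else 0)) =
      (if i = j then root_char p (int (Suc a) * int j) else 0)" if "i < p" "j < p" for i j
  proof -
    have "(\<Sum>l<p. (if i = l then root_char p (int a * int l) else 0) *
      (if l = j then cis (2 * pi * real j / real p) else 0)) =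
      (\<Sum>l<p. if l = j then (if i = j then root_char p (int a * int j) *
         cis (2 * pi * real j / real p) else 0) else 0)"
      by (intro sum.cong) auto
    also have "root_char p (int a * int j) * cis (2 * pi * real j / real p) =
        root_char p (int (Suc a) * int j)"
      using root_char_add[of p "int a * int j" "int j"] by (simp add: root_char_def algebra_simps)
    finally show ?thesis using that by simp
  qed
  then show ?case
    unfolding pow_mat.simps Suc
    by (intro eq_matI) (auto simp: clock_op_def index_mult_mat_sum[of _ p p _ p] simp del: index_mult_mat(1))
qed

lemma shift_op_power: "shift_op p ^\<^sub>m a = mat p p (\<lambda>(i, j). if i = (j + a) mod p then 1 else 0)"
proof (induction a)
  case 0
  show ?case by (auto simp: shift_op_def)
next
  case (Suc a)
  have "(\<Sum>l<p. (if i = (l + a) mod p then 1 else 0) * (if l = (j + 1) mod p then 1 else 0)) =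
      (if i = (j + Suc a) mod p then 1 else (0 :: complex))" if "i < p" "j < p" for i j
  proof -
    have "(\<Sum>l<p. (if i = (l + a) mod p then 1 else 0) * (if l = (j + 1) mod p then 1 else 0)) =
      (\<Sum>l<p. if l = (j + 1) mod p then (if i = ((j + 1) mod p + a) mod p then 1 else (0 :: complex)) else 0)"
      by (intro sum.cong) auto
    then show ?thesis using that by (simp add: mod_simps)
  qed
  then show ?case
    unfolding pow_mat.simps Suc
    by (intro eq_matI) (auto simp: shift_op_def index_mult_mat_sum[of _ p p _ p] simp del: index_mult_mat(1))
qed

text \<open>Since p is odd, p + 1 = 2h with h an integer, and the prefactor is the character at - h
  a b. The clock operator stands on the left of the shift, hence the remaining phase depends on the
  row index i.\<close>

lemma displacement1_eq_weyl:
  assumes "odd p"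
  shows "displacement1 p (a, b) = weyl p (int a) (int b)"
proof (rule eq_matI)
  have p: "p > 0" using assms odd_pos by blast
  have h: "2 * real ((p + 1) div 2) = real p + 1" using assms by (auto elim!: oddE)
  have phase: "cis (- (real ((p + 1) * a * b) * pi / real p)) =
      root_char p (- (int ((p + 1) div 2) * int a * int b))"
  proof -
    have "- (real ((p + 1) * a * b) * pi / real p) =
      - ((2 * real ((p + 1) div 2)) * real a * real b * pi / real p)"
      unfolding h by (simp add: algebra_simps)
    also have "\<dots> = 2 * pi * of_int (- (int ((p + 1) div 2) * int a * int b)) / of_nat p"
      by simp
    finally show ?thesis unfolding root_char_def by (rule arg_cong)
  qed
  fix i j
  assume "i < dim_row (weyl p (int a) (int b))" "j < dim_col (weyl p (int a) (int b))"
  then have ij: "i < p" "j < p" by (auto simp: weyl_def)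
  have iff: "i = (j + b) mod p \<longleftrightarrow> int p dvd int i - int j - int b"
    using dvd_diff_iff_mod[OF p ij(1), of "int j + int b"]
    by (simp add: diff_diff_eq nat_mod_distrib flip: of_nat_add of_nat_mod)
  have "(clock_op p ^\<^sub>m a * shift_op p ^\<^sub>m b) $$ (i, j) =
      (\<Sum>l<p. (clock_op p ^\<^sub>m a) $$ (i, l) * (shift_op p ^\<^sub>m b) $$ (l, j))"
    using ij by (intro index_mult_mat_sum) (auto simp: clock_op_power shift_op_power)
  also have "\<dots> = (\<Sum>l<p. if l = i then root_char p (int a * int i) *
      (if i = (j + b) mod p then 1 else 0) else 0)"
    using ij by (intro sum.cong) (auto simp: clock_op_power shift_op_power)
  also have "\<dots> = root_char p (int a * int i) * (if i = (j + b) mod p then 1 else 0)"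
    using ij by simp
  finally show "displacement1 p (a, b) $$ (i, j) = weyl p (int a) (int b) $$ (i, j)"
    using ij iff root_char_add[of p "int a * int i" "- (int ((p + 1) div 2) * int a * int b)"]
    unfolding displacement1_def prod.case phase
    by (simp add: weyl_def clock_op_power shift_op_power del: index_mult_mat(1))
qed (auto simp: displacement1_def weyl_def clock_op_power shift_op_power)

lemma displacement1_carrier:
  "odd p \<Longrightarrow> displacement1 p u \<in> carrier_mat p p"
  by (cases u) (simp add: displacement1_eq_weyl)

section \<open>Traces of displacement operators against phase-point operators\<close>

lemma phase_point0_carrier [simp, intro]: "phase_point0 p \<in> carrier_mat p p"
  by (simp add: phase_point0_def)

lemma phase_point1_carrier:
  "odd p \<Longrightarrow> phase_point1 p u \<in> carrier_mat p p"
  unfolding phase_point1_def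
  by (intro mult_carrier_mat[of _ p p _ p] mat_adjoint_carrier displacement1_carrier) auto

text \<open>By trace orthogonality, the displacement at (-x, -y) modulo p is the only summand of
  \<open>phase_point0\<close> that contributes. Its contribution p cancels the normalization
  1/p.\<close>

lemma mat_trace_weyl_phase_point0:
  assumes "odd p"
  shows "mat_trace (weyl p x y * phase_point0 p) = 1"
proof -
  let ?h = "int ((p + 1) div 2)"
  have p: "p > 0" using assms odd_pos by blast
  \<comment> \<open>Representatives in {..<p} of -x and -y.\<close>
  let ?a = "nat (- x mod int p)" and ?b = "nat (- y mod int p)"
  have ab: "?a < p" "?b < p" using p by (simp_all add: nat_less_iff)
  have "mat_trace (weyl p x y * phase_point0 p) = mat_trace (phase_point0 p * weyl p x y)"
    by (rule mat_trace_mult_comm) auto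
  also have "\<dots> = (1 / of_nat p) *
      mat_trace (mat_sum p (displacement1 p) ({..<p} \<times> {..<p}) * weyl p x y)"
    unfolding phase_point0_def by (rule mat_trace_smult_mult) auto
  also have "mat_trace (mat_sum p (displacement1 p) ({..<p} \<times> {..<p}) * weyl p x y) =
      (\<Sum>u\<in>{..<p} \<times> {..<p}. mat_trace (displacement1 p u * weyl p x y))"
    using assms by (intro mat_trace_mat_sum_mult displacement1_carrier) auto
  also have "\<dots> = (\<Sum>u\<in>{..<p} \<times> {..<p}. if u = (?a, ?b) then of_nat p else 0)"
  proof (rule sum.cong[OF refl])
    fix u assume "u \<in> {..<p} \<times> {..<p}"
    then obtain a b where u: "u = (a, b)" and less: "a < p" "b < p" by auto
    have iff: "int p dvd int a + x \<longleftrightarrow> a = ?a" "int p dvd int b + y \<longleftrightarrow> b = ?b"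
      using dvd_diff_iff_mod[OF p less(1), of "- x"] dvd_diff_iff_mod[OF p less(2), of "- y"] by auto
    \<comment> \<open>The symplectic form of two opposite points vanishes modulo p, so the
      composition law adds no phase to the surviving term.\<close>
    have one: "root_char p (?h * (int a * y - x * int b)) = 1"
      if d: "int p dvd int a + x" "int p dvd int b + y"
    proof -
      have "int a * y - x * int b = (int a + x) * y - x * (int b + y)"
        by (simp add: algebra_simps)
      then have "int p dvd int a * y - x * int b"
        using d by (metis dvd_diff dvd_mult dvd_mult2)
      then show ?thesis
        using p by (simp add: root_char_eq_1_iff)
    qed
    have "mat_trace (displacement1 p (a, b) * weyl p x y) =
        root_char p (?h * (int a * y - x * int b)) * mat_trace (weyl p (int a + x) (int b + y))"
      using assms by (simp add: displacement1_eq_weyl weyl_mult mat_trace_smult[of _ p])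
    also have "\<dots> = (if a = ?a \<and> b = ?b then of_nat p else 0)"
      using p one iff by (simp add: mat_trace_weyl)
    finally show "mat_trace (displacement1 p u * weyl p x y) =
        (if u = (?a, ?b) then of_nat p else 0)"
      by (simp add: u)
  qed
  also have "\<dots> = of_nat p"
    using ab by simp
  finally show ?thesis using p by simp
qed

text \<open>Conjugating a Weyl operator by a displacement multiplies it by the character of the
  symplectic form. Cyclicity of the trace transfers the conjugation from the phase-point operator to
  \<open>weyl p x y\<close>, which leaves the trace at the origin, equal to 1.\<close>

lemma mat_trace_weyl_phase_point1:
  assumes "odd p"
  shows "mat_trace (weyl p x y * phase_point1 p (a, b)) = root_char p (x * int b - int a * y)"
proof -
  let ?h = "int ((p + 1) div 2)"
  have p: "p > 0" using assms odd_pos by blast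
  have h: "2 * ?h = int p + 1" using assms by (auto elim!: oddE)
  let ?T = "weyl p (int a) (int b)" and ?T' = "weyl p (- int a) (- int b)"
  have c[simp]: "?T \<in> carrier_mat p p" "?T' \<in> carrier_mat p p" "weyl p x y \<in> carrier_mat p p"
    "phase_point0 p \<in> carrier_mat p p" by auto
  have "weyl p x y * phase_point1 p (a, b) = (weyl p x y * ?T * phase_point0 p) * ?T'"
    using assms by (simp add: phase_point1_def displacement1_eq_weyl mat_adjoint_weyl
        assoc_mult_mat[of _ p p _ p _ p] mult_carrier_mat[of _ p p _ p])
  then have "mat_trace (weyl p x y * phase_point1 p (a, b)) =
      mat_trace (?T' * (weyl p x y * ?T * phase_point0 p))"
    by (simp add: mat_trace_mult_comm[of _ p p] mult_carrier_mat[of _ p p _ p])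
  also have "?T' * (weyl p x y * ?T * phase_point0 p) = (?T' * weyl p x y) * ?T * phase_point0 p"
    by (simp add: assoc_mult_mat[of _ p p _ p _ p] mult_carrier_mat[of _ p p _ p])
  also have "(?T' * weyl p x y) * ?T = (root_char p (?h * (- int a * y - x * - int b)) *
      root_char p (?h * ((- int a + x) * int b - int a * (- int b + y)))) \<cdot>\<^sub>m weyl p x y"
    using assms by (simp add: weyl_mult mult_smult_assoc_mat[of _ p p _ p] smult_smult_mat)
  also have "mat_trace (\<dots> * phase_point0 p) = root_char p (?h * (- int a * y - x * - int b)) *
      root_char p (?h * ((- int a + x) * int b - int a * (- int b + y)))"
    using assms by (simp add: mat_trace_smult_mult[of _ p] mat_trace_weyl_phase_point0)
  \<comment> \<open>Each of the two multiplications contributes h times the symplectic form; the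
    total factor 2h is congruent to 1 modulo p.\<close>
  also have "\<dots> = root_char p ((2 * ?h) * (x * int b - int a * y))"
    by (simp flip: root_char_add) (simp add: algebra_simps)
  also have "\<dots> = root_char p (x * int b - int a * y)"
    unfolding h using p by (intro root_char_cong) (auto simp: algebra_simps)
  finally show ?thesis .
qed

lemma mat_trace_phase_point1:
  assumes "odd p"
  shows "mat_trace (phase_point1 p u) = 1"
proof -
  have p: "p > 0" using assms odd_pos by blast
  obtain a b where u: "u = (a, b)" by fastforce
  show ?thesis
    using mat_trace_weyl_phase_point1[OF assms, of 0 0 a b] phase_point1_carrier[OF assms, of u] p
    by (simp add: weyl_0 u)
qed

text \<open>The phase \<open>\<tau>\<close> is the square root, of odd order, of the commutation factor of the two
  displacements; hence it is 1 as soon as they commute.\<close>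

lemma displacement1_mult:
  assumes "odd p"
  obtains \<tau> where "\<tau> ^ p = 1"
    "displacement1 p v * displacement1 p w = \<tau>\<^sup>2 \<cdot>\<^sub>m (displacement1 p w * displacement1 p v)"
    "mat_trace (displacement1 p v * displacement1 p w * phase_point1 p u) =
      \<tau> * (mat_trace (displacement1 p v * phase_point1 p u) *
           mat_trace (displacement1 p w * phase_point1 p u))"
proof -
  let ?h = "int ((p + 1) div 2)"
  have p: "p > 0" using assms odd_pos by blast
  obtain v1 v2 where v: "v = (v1, v2)" by fastforce
  obtain w1 w2 where w: "w = (w1, w2)" by fastforce
  obtain u1 u2 where u: "u = (u1, u2)" by fastforce
  let ?\<tau> = "root_char p (?h * (int v1 * int w2 - int w1 * int v2))"
  have 1: "?\<tau> ^ p = 1"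
    using p by (simp add: root_char_power root_char_eq_1_iff)
  have 2: "displacement1 p v * displacement1 p w = ?\<tau>\<^sup>2 \<cdot>\<^sub>m (displacement1 p w * displacement1 p v)"
  proof -
    \<comment> \<open>In the opposite order the composition law gives the inverse phase, so the two
      products differ by the factor \<open>\<tau>\<^sup>2\<close>.\<close>
    have "?\<tau>\<^sup>2 * root_char p (?h * (int w1 * int v2 - int v1 * int w2)) = ?\<tau>"
      unfolding power2_eq_square by (simp flip: root_char_add) (simp add: algebra_simps)
    then show ?thesis
      using assms by (simp add: v w displacement1_eq_weyl weyl_mult smult_smult_mat add.commute)
  qed
  have 3: "mat_trace (displacement1 p v * displacement1 p w * phase_point1 p u) =
      ?\<tau> * (mat_trace (displacement1 p v * phase_point1 p u) *
           mat_trace (displacement1 p w * phase_point1 p u))"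
    using assms
    by (simp add: v w u displacement1_eq_weyl weyl_mult mat_trace_smult_mult[of _ p]
        phase_point1_carrier mat_trace_weyl_phase_point1 flip: root_char_add)
      (simp add: algebra_simps)
  show ?thesis using 1 2 3 by (rule that)
qed

subsection \<open>Tensor products and stabilizer states\<close>

lemma phase_space_ConsE:
  assumes "us \<in> phase_space (p # ps)"
  obtains u us' where "us = u # us'" "us' \<in> phase_space ps"
  using assms by (auto simp: phase_space_def list_all2_Cons1)

lemma displacement_Nil: "displacement [] us = 1\<^sub>m 1"
  by (simp add: displacement_def tensor_def)

lemma displacement_Cons:
  "displacement (p # ps) (u # us) = kron (displacement1 p u) (displacement ps us)"
  by (simp add: displacement_def tensor_def)

lemma phase_point_Nil: "phase_point [] us = 1\<^sub>m 1"
  by (simp add: phase_point_def tensor_def)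

lemma phase_point_Cons:
  "phase_point (p # ps) (u # us) = kron (phase_point1 p u) (phase_point ps us)"
  by (simp add: phase_point_def tensor_def)

lemma displacement_carrier:
  assumes "\<forall>p \<in> set ps. odd p" "us \<in> phase_space ps"
  shows "displacement ps us \<in> carrier_mat (prod_list ps) (prod_list ps)"
  using assms
  by (induction ps arbitrary: us)
    (auto simp: displacement_Nil displacement_Cons elim!: phase_space_ConsE
      intro!: kron_carrier displacement1_carrier)

lemma phase_point_carrier:
  assumes "\<forall>p \<in> set ps. odd p" "us \<in> phase_space ps"
  shows "phase_point ps us \<in> carrier_mat (prod_list ps) (prod_list ps)"
  using assms
  by (induction ps arbitrary: us)
    (auto simp: phase_point_Nil phase_point_Cons elim!: phase_space_ConsE
      intro!: kron_carrier phase_point1_carrier)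

lemma mat_trace_phase_point:
  assumes "\<forall>p \<in> set ps. odd p" "us \<in> phase_space ps"
  shows "mat_trace (phase_point ps us) = 1"
  using assms
proof (induction ps arbitrary: us)
  case Nil
  then show ?case by (simp add: phase_point_Nil mat_trace_def)
next
  case (Cons p ps)
  obtain u us' where us: "us = u # us'" "us' \<in> phase_space ps"
    using Cons.prems(2) by (rule phase_space_ConsE)
  have "mat_trace (phase_point (p # ps) us) = mat_trace (phase_point1 p u) * mat_trace (phase_point ps us')"
    unfolding us phase_point_Cons
    by (rule mat_trace_kron[OF phase_point1_carrier phase_point_carrier]) (use us Cons.prems in auto)
  then show ?case using Cons us by (simp add: mat_trace_phase_point1)
qed

text \<open>The single-system relation of \<open>displacement1_mult\<close> passes to tensor
  products by induction: products and traces are taken factor by factor, so the phases of the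
  factors multiply.\<close>

lemma displacement_mult:
  assumes "\<forall>p \<in> set ps. odd p"
    "v \<in> phase_space ps" "w \<in> phase_space ps" "u \<in> phase_space ps"
  shows "\<exists>\<tau>. \<tau> ^ prod_list ps = 1 \<and>
    displacement ps v * displacement ps w = \<tau>\<^sup>2 \<cdot>\<^sub>m (displacement ps w * displacement ps v) \<and>
    mat_trace (displacement ps v * displacement ps w * phase_point ps u) =
      \<tau> * (mat_trace (displacement ps v * phase_point ps u) *
           mat_trace (displacement ps w * phase_point ps u))"
  using assms
proof (induction ps arbitrary: v w u)
  case Nil
  then show ?case
    by (intro exI[of _ 1]) (simp add: displacement_Nil phase_point_Nil mat_trace_def one_smult_mat)
next
  case (Cons p ps)
  let ?d = "prod_list ps"
  obtain v1 v' where v: "v = v1 # v'" "v' \<in> phase_space ps"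
    using Cons.prems(2) by (rule phase_space_ConsE)
  obtain w1 w' where w: "w = w1 # w'" "w' \<in> phase_space ps"
    using Cons.prems(3) by (rule phase_space_ConsE)
  obtain u1 u' where u: "u = u1 # u'" "u' \<in> phase_space ps"
    using Cons.prems(4) by (rule phase_space_ConsE)
  have p: "odd p" and ps: "\<forall>p \<in> set ps. odd p" using Cons.prems(1) by auto
  obtain \<tau> where \<tau>: "\<tau> ^ p = 1"
    "displacement1 p v1 * displacement1 p w1 = \<tau>\<^sup>2 \<cdot>\<^sub>m (displacement1 p w1 * displacement1 p v1)"
    "mat_trace (displacement1 p v1 * displacement1 p w1 * phase_point1 p u1) =
      \<tau> * (mat_trace (displacement1 p v1 * phase_point1 p u1) *
           mat_trace (displacement1 p w1 * phase_point1 p u1))"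
    using p by (rule displacement1_mult)
  obtain \<sigma> where \<sigma>: "\<sigma> ^ ?d = 1"
    "displacement ps v' * displacement ps w' = \<sigma>\<^sup>2 \<cdot>\<^sub>m (displacement ps w' * displacement ps v')"
    "mat_trace (displacement ps v' * displacement ps w' * phase_point ps u') =
      \<sigma> * (mat_trace (displacement ps v' * phase_point ps u') *
           mat_trace (displacement ps w' * phase_point ps u'))"
    using Cons.IH[OF ps v(2) w(2) u(2)] by blast
  have c1: "displacement1 p x \<in> carrier_mat p p" "phase_point1 p x \<in> carrier_mat p p"
    "displacement1 p x * displacement1 p y \<in> carrier_mat p p"
    "displacement1 p x * phase_point1 p y \<in> carrier_mat p p"
    "displacement1 p x * displacement1 p y * phase_point1 p z \<in> carrier_mat p p" for x y z
    using p by (simp_all add: displacement1_carrier phase_point1_carrier mult_carrier_mat[of _ p p _ p])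
  have c: "displacement ps v' \<in> carrier_mat ?d ?d" "displacement ps w' \<in> carrier_mat ?d ?d"
    "phase_point ps u' \<in> carrier_mat ?d ?d"
    using ps u(2) v(2) w(2) by (auto intro: displacement_carrier phase_point_carrier)
  then have c2: "displacement ps v' * displacement ps w' \<in> carrier_mat ?d ?d"
    "displacement ps w' * displacement ps v' \<in> carrier_mat ?d ?d"
    "displacement ps v' * phase_point ps u' \<in> carrier_mat ?d ?d"
    "displacement ps w' * phase_point ps u' \<in> carrier_mat ?d ?d"
    "displacement ps v' * displacement ps w' * phase_point ps u' \<in> carrier_mat ?d ?d"
    by auto
  note mult = kron_mult[of _ p _ ?d]
  \<comment> \<open>The orders of the two phases divide p and \<open>?d\<close>, so the order of
    their product divides the product of these numbers.\<close>
  have "(\<tau> * \<sigma>) ^ prod_list (p # ps) = (\<tau> ^ p) ^ ?d * (\<sigma> ^ ?d) ^ p"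
    by (simp add: power_mult_distrib mult.commute[of p] flip: power_mult)
  then have "(\<tau> * \<sigma>) ^ prod_list (p # ps) = 1"
    by (simp add: \<tau>(1) \<sigma>(1))
  moreover have "displacement (p # ps) v * displacement (p # ps) w =
      (\<tau> * \<sigma>)\<^sup>2 \<cdot>\<^sub>m (displacement (p # ps) w * displacement (p # ps) v)"
    by (simp add: v(1) w(1) displacement_Cons mult c1 c c2 \<tau>(2) \<sigma>(2) kron_smult[of _ p _ ?d]
        power_mult_distrib)
  moreover have "mat_trace (displacement (p # ps) v * displacement (p # ps) w * phase_point (p # ps) u) =
      \<tau> * \<sigma> * (mat_trace (displacement (p # ps) v * phase_point (p # ps) u) *
           mat_trace (displacement (p # ps) w * phase_point (p # ps) u))"
    by (simp add: v(1) w(1) u(1) displacement_Cons phase_point_Cons mult c1 c c2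
        mat_trace_kron[of _ p _ ?d] \<tau>(3) \<sigma>(3))
  ultimately show ?case by blast
qed

text \<open>Writing d = 2k + 1, the d-th power of \<tau> is \<tau> itself. This is where odd
  dimension enters: in even dimension \<tau> = -1 would remain possible.\<close>

lemma eq_1_if_odd_root_and_square:
  fixes \<tau> :: complex
  assumes "\<tau> ^ d = 1" "odd d" "\<tau>\<^sup>2 = 1"
  shows "\<tau> = 1"
  using assms by (auto elim!: oddE simp: power_mult)

text \<open>The value is the average over G of a character of G: it is 1 for the trivial character
  and 0 for any other one.\<close>

lemma wigner_stabilizer_state:
  assumes ps: "\<forall>p \<in> set ps. odd p" and \<psi>: "pure_stabilizer_state ps \<psi>" and u: "u \<in> phase_space ps"
  shows "wigner ps (proj \<psi>) u \<in> {0, 1}"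
proof -
  define d where "d = prod_list ps"
  have "odd d" using ps unfolding d_def by (induction ps) auto
  then have d: "d > 0" using odd_pos by blast
  obtain G where G: "finite G" "comm_group \<lparr>carrier = G, monoid.mult = (*), one = 1\<^sub>m d\<rparr>"
    "\<And>g. g \<in> G \<Longrightarrow> unitary_mat d g"
    "\<And>g. g \<in> G \<Longrightarrow> \<exists>c. \<exists>u \<in> phase_space ps. cmod c = 1 \<and> g = c \<cdot>\<^sub>m displacement ps u"
    and proj: "proj \<psi> = (1 / of_nat (card G)) \<cdot>\<^sub>m mat_sum d (\<lambda>g. g) G"
    using \<psi> unfolding pure_stabilizer_state_def Let_def d_def by blast
  interpret comm_group "\<lparr>carrier = G, monoid.mult = (*), one = 1\<^sub>m d\<rparr>" by (rule G(2))
  let ?A = "phase_point ps u"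
  have A: "?A \<in> carrier_mat d d"
    using ps u unfolding d_def by (rule phase_point_carrier)
  have carr: "g \<in> carrier_mat d d" if "g \<in> G" for g
    using G(3)[OF that] by (simp add: unitary_mat_def)
  define \<chi> where "\<chi> g = mat_trace (g * ?A)" for g
  have one: "1\<^sub>m d \<in> G" using one_closed by simp
  have closed: "g * h \<in> G" if "g \<in> G" "h \<in> G" for g h
    using m_closed[of g h] that by simp
  \<comment> \<open>Write both elements as scalars times displacements. The trace is multiplicative
    up to \<tau>, and commutativity of G forces \<tau> = 1.\<close>
  have hom: "\<chi> (g * h) = \<chi> g * \<chi> h" if g: "g \<in> G" and h: "h \<in> G" for g h
  proof -
    obtain a v where v: "v \<in> phase_space ps" "cmod a = 1" "g = a \<cdot>\<^sub>m displacement ps v"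
      using G(4)[OF g] by blast
    obtain b w where w: "w \<in> phase_space ps" "cmod b = 1" "h = b \<cdot>\<^sub>m displacement ps w"
      using G(4)[OF h] by blast
    let ?V = "displacement ps v" and ?W = "displacement ps w"
    have [simp]: "?V \<in> carrier_mat d d" "?W \<in> carrier_mat d d"
      using ps v(1) w(1) unfolding d_def by (auto intro: displacement_carrier)
    then have [simp]: "?V * ?W \<in> carrier_mat d d" "?W * ?V \<in> carrier_mat d d"
      by (simp_all add: mult_carrier_mat[of _ d d _ d])
    obtain \<tau> where \<tau>: "\<tau> ^ d = 1" "?V * ?W = \<tau>\<^sup>2 \<cdot>\<^sub>m (?W * ?V)"
      "mat_trace (?V * ?W * ?A) = \<tau> * (mat_trace (?V * ?A) * mat_trace (?W * ?A))"
      using displacement_mult[OF ps v(1) w(1) u] unfolding d_def by blast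
    have gh: "g * h = (a * b) \<cdot>\<^sub>m (?V * ?W)" and hg: "h * g = (a * b) \<cdot>\<^sub>m (?W * ?V)"
      by (auto simp: v(3) w(3) mult_smult_assoc_mat[of _ d d _ d] mult_smult_distrib[of _ d d _ d]
          smult_smult_mat mult.commute)
    have comm: "g * h = h * g" using m_comm[of g h] g h by simp
    \<comment> \<open>Commutativity gives
      \<open>h * g = \<tau>\<^sup>2 \<cdot>\<^sub>m (h * g)\<close>. If the factor were not 1, the
      unitary \<open>h * g\<close> would be the zero matrix, which is impossible as d > 0.\<close>
    have "\<tau>\<^sup>2 = 1"
    proof (rule ccontr)
      assume ne: "\<tau>\<^sup>2 \<noteq> 1"
      have "(h * g) $$ (i, j) = 0" if "i < d" "j < d" for i j
      proof -
        have "(h * g) $$ (i, j) = \<tau>\<^sup>2 * (h * g) $$ (i, j)"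
        proof -
          have "h * g = (a * b) \<cdot>\<^sub>m (\<tau>\<^sup>2 \<cdot>\<^sub>m (?W * ?V))"
            unfolding comm[symmetric] gh \<tau>(2) ..
          also have "\<dots> = \<tau>\<^sup>2 \<cdot>\<^sub>m (h * g)"
            unfolding hg by (simp only: smult_smult_mat mult_ac)
          finally have "h * g = \<tau>\<^sup>2 \<cdot>\<^sub>m (h * g)" .
          then show ?thesis
            using that carrier_matD[OF carr[OF closed[OF h g]]]
            by (metis index_smult_mat(1))
        qed
        then show ?thesis using ne by simp
      qed
      then have zero: "h * g = 0\<^sub>m d d"
        using carr[OF closed[OF h g]] by (intro eq_matI) auto
      have "1\<^sub>m d = (0\<^sub>m d d :: complex mat)"
        using G(3)[OF closed[OF h g]] right_mult_zero_mat[of "mat_adjoint (0\<^sub>m d d :: complex mat)" d d d]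
        unfolding unitary_mat_def zero by (simp add: mat_adjoint_carrier)
      then have "(1\<^sub>m d :: complex mat) $$ (0, 0) = 0\<^sub>m d d $$ (0, 0)" by simp
      then show False using d by simp
    qed
    then have "\<tau> = 1"
      using eq_1_if_odd_root_and_square[OF \<tau>(1) \<open>odd d\<close>] by blast
    then have "\<chi> (g * h) = (a * b) * (mat_trace (?V * ?A) * mat_trace (?W * ?A))"
      using A by (simp add: \<chi>_def gh mat_trace_smult_mult[of _ d] \<tau>(3))
    also have "\<dots> = \<chi> g * \<chi> h"
      using A by (simp add: \<chi>_def v(3) w(3) mat_trace_smult_mult[of _ d])
    finally show ?thesis .
  qed
  have W: "wigner ps (proj \<psi>) u = (\<Sum>g\<in>G. \<chi> g) / of_nat (card G)"
    unfolding wigner_def proj \<chi>_def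
    using A carr by (simp add: mat_trace_smult_mult[of _ d] mat_trace_mat_sum_mult)
  have card: "card G > 0" using one G(1) by (auto simp: card_gt_0_iff)
  show ?thesis
  proof (cases "\<forall>g\<in>G. \<chi> g = 1")
    case True
    then show ?thesis using W card by simp
  next
    case False
    then obtain h where h: "h \<in> G" "\<chi> h \<noteq> 1" by blast
    \<comment> \<open>Left multiplication by h permutes G. The sum thus equals \<chi> h times itself
      and must vanish.\<close>
    have "(\<Sum>g\<in>G. \<chi> g) = (\<Sum>g\<in>G. \<chi> (h * g))"
    proof -
      have inj: "inj_on ((*) h) G"
        using inj_on_cmult[of h] h(1) by simp
      have "(*) h ` G = G"
        using G(1) closed[OF h(1)] inj by (intro endo_inj_surj) auto
      then show ?thesis
        using sum.reindex[OF inj, of \<chi>] by (simp add: o_def)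
    qed
    also have "\<dots> = \<chi> h * (\<Sum>g\<in>G. \<chi> g)"
      by (simp add: hom h(1) sum_distrib_left)
    finally have "(\<Sum>g\<in>G. \<chi> g) = 0" using h(2) by simp
    then show ?thesis using W by simp
  qed
qed

subsection \<open>Positivity of the effects\<close>

lemma proj_carrier [intro]: "\<psi> \<in> carrier_vec d \<Longrightarrow> proj \<psi> \<in> carrier_mat d d"
  by (auto simp: proj_def)

lemma proj_mult_vec:
  assumes "\<psi> \<in> carrier_vec d" "v \<in> carrier_vec d"
  shows "proj \<psi> *\<^sub>v v = (v \<bullet>c \<psi>) \<cdot>\<^sub>v \<psi>"
  using assms
  by (intro eq_vecI) (auto simp: proj_def scalar_prod_def sum_distrib_right sum_distrib_left mult_ac intro!: sum.cong)

lemma inner_commute: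
  fixes v w :: "complex vec"
  assumes "v \<in> carrier_vec d" "w \<in> carrier_vec d"
  shows "w \<bullet>c v = cnj (v \<bullet>c w)"
  using assms by (auto simp: scalar_prod_def mult_ac intro!: sum.cong)

lemma inner_proj_mult_vec:
  assumes "\<psi> \<in> carrier_vec d" "v \<in> carrier_vec d"
  shows "(proj \<psi> *\<^sub>v v) \<bullet>c v = of_real ((cmod (v \<bullet>c \<psi>))\<^sup>2)"
proof -
  have "(proj \<psi> *\<^sub>v v) \<bullet>c v = (v \<bullet>c \<psi>) * (\<psi> \<bullet>c v)"
    using assms by (subst proj_mult_vec[OF assms]) simp
  also have "\<dots> = of_real ((cmod (v \<bullet>c \<psi>))\<^sup>2)"
    using inner_commute[OF assms(2,1)] by (simp add: complex_mult_cnj cmod_power2)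
  finally show ?thesis .
qed

text \<open>The double sum for the trace factors into two inner products, so orthogonality of the
  vectors makes it vanish and normalization makes it 1 for equal vectors.\<close>

lemma mat_trace_proj_mult_proj:
  assumes "\<psi> \<in> carrier_vec d" "\<phi> \<in> carrier_vec d"
  shows "mat_trace (proj \<psi> * proj \<phi>) = (\<psi> \<bullet>c \<phi>) * (\<phi> \<bullet>c \<psi>)"
proof -
  have "mat_trace (proj \<psi> * proj \<phi>) =
      (\<Sum>i<d. \<Sum>j<d. (\<psi> $ i * cnj (\<phi> $ i)) * (\<phi> $ j * cnj (\<psi> $ j)))"
    using assms by (subst mat_trace_mult[of _ d d]) (auto simp: proj_def mult_ac)
  also have "\<dots> = (\<psi> \<bullet>c \<phi>) * (\<phi> \<bullet>c \<psi>)"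
    using assms by (auto simp: scalar_prod_def lessThan_atLeast0 sum_product)
  finally show ?thesis .
qed

text \<open>The triangle inequality reduces the claim to the real Cauchy-Schwarz inequality for the
  moduli of the entries, \<open>L2_set_mult_ineq\<close>.\<close>

lemma Cauchy_Schwarz_complex_vec:
  fixes v w :: "complex vec"
  assumes "v \<in> carrier_vec d" "w \<in> carrier_vec d"
  shows "(cmod (v \<bullet>c w))\<^sup>2 \<le> Re (v \<bullet>c v) * Re (w \<bullet>c w)"
proof -
  have norm: "Re (x \<bullet>c x) = (\<Sum>i<d. (cmod (x $ i))\<^sup>2)" if "x \<in> carrier_vec d" for x :: "complex vec"
    using that by (auto simp: scalar_prod_def lessThan_atLeast0 cmod_power2 simp flip: power2_eq_square intro!: sum.cong)
  have "cmod (v \<bullet>c w) \<le> (\<Sum>i<d. cmod (v $ i) * cmod (w $ i))"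
    using assms by (auto simp: scalar_prod_def lessThan_atLeast0 norm_mult intro!: sum_norm_le)
  then have "(cmod (v \<bullet>c w))\<^sup>2 \<le> (\<Sum>i<d. cmod (v $ i) * cmod (w $ i))\<^sup>2"
    by (intro power_mono) auto
  also have "\<dots> \<le> (L2_set (\<lambda>i. cmod (v $ i)) {..<d} * L2_set (\<lambda>i. cmod (w $ i)) {..<d})\<^sup>2"
    using L2_set_mult_ineq[of "\<lambda>i. cmod (v $ i)" "\<lambda>i. cmod (w $ i)" "{..<d}"]
    by (intro power_mono sum_nonneg) auto
  also have "\<dots> = (\<Sum>i<d. (cmod (v $ i))\<^sup>2) * (\<Sum>i<d. (cmod (w $ i))\<^sup>2)"
    by (simp add: L2_set_def power_mult_distrib sum_nonneg)
  finally show ?thesis using assms by (simp add: norm)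
qed

section \<open>Positive semidefiniteness of scaled projectors and of the remainder\<close>

lemma inner_mat_mult_vec:
  assumes "A \<in> carrier_mat d d" "v \<in> carrier_vec d"
  shows "(A *\<^sub>v v) \<bullet>c v = (\<Sum>i<d. \<Sum>j<d. A $$ (i, j) * v $ j * cnj (v $ i))"
  using assms by (auto simp: scalar_prod_def lessThan_atLeast0 sum_distrib_right intro!: sum.cong)

lemma psd_mat_smult:
  assumes "psd_mat d A" "c \<ge> 0"
  shows "psd_mat d (complex_of_real c \<cdot>\<^sub>m A)"
  unfolding psd_mat_def
proof (intro conjI ballI)
  have A: "A \<in> carrier_mat d d" and adj: "mat_adjoint A = A"
    using assms(1) by (simp_all add: psd_mat_def)
  show "complex_of_real c \<cdot>\<^sub>m A \<in> carrier_mat d d" using A by simp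
  have "cnj (A $$ (j, i)) = A $$ (i, j)" if "i < d" "j < d" for i j
    using index_mat_adjoint[OF A that] adj by simp
  then show "mat_adjoint (complex_of_real c \<cdot>\<^sub>m A) = complex_of_real c \<cdot>\<^sub>m A"
    using A by (intro eq_matI) (auto simp: index_mat_adjoint[of _ d d] mat_adjoint_def mat_of_rows_def)
  fix v :: "complex vec" assume v: "v \<in> carrier_vec d"
  then have "((complex_of_real c \<cdot>\<^sub>m A) *\<^sub>v v) \<bullet>c v = complex_of_real c * ((A *\<^sub>v v) \<bullet>c v)"
    using A by (simp add: inner_mat_mult_vec[of _ d] sum_distrib_left mult.assoc)
  moreover have "0 \<le> (A *\<^sub>v v) \<bullet>c v"
    using assms(1) v by (simp add: psd_mat_def)
  ultimately show "0 \<le> ((complex_of_real c \<cdot>\<^sub>m A) *\<^sub>v v) \<bullet>c v"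
    using assms(2) by (simp add: less_eq_complex_def)
qed

lemma mat_adjoint_proj: "mat_adjoint (proj \<psi>) = proj \<psi>"
proof -
  have c: "proj \<psi> \<in> carrier_mat (dim_vec \<psi>) (dim_vec \<psi>)"
    by (simp add: proj_def)
  show ?thesis
    using c by (intro eq_matI) (auto simp: index_mat_adjoint[OF c] proj_def mat_adjoint_def mat_of_rows_def mult.commute)
qed

lemma psd_mat_proj:
  assumes "\<psi> \<in> carrier_vec d"
  shows "psd_mat d (proj \<psi>)"
  using assms
  by (auto simp: psd_mat_def mat_adjoint_proj inner_proj_mult_vec less_eq_complex_def)

text \<open>Against a vector v each unit vector has squared overlap at most the squared norm of v.
  The n terms of weight c together remove at most n c times that norm, which leaves a nonnegative
  quadratic form.\<close>

lemma psd_mat_one_minus_sum_proj: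
  assumes \<psi>: "\<And>i. i < n \<Longrightarrow> \<psi> i \<in> carrier_vec d" "\<And>i. i < n \<Longrightarrow> \<psi> i \<bullet>c \<psi> i = 1"
    and c: "0 \<le> c" "real n * c \<le> 1"
  shows "psd_mat d (1\<^sub>m d - mat_sum d (\<lambda>i. complex_of_real c \<cdot>\<^sub>m proj (\<psi> i)) {..<n})"
    (is "psd_mat d (1\<^sub>m d - ?S)")
  unfolding psd_mat_def
proof (intro conjI ballI)
  show carr: "1\<^sub>m d - ?S \<in> carrier_mat d d" by (intro minus_carrier_mat) simp
  have entry: "(1\<^sub>m d - ?S) $$ (i, j) = (if i = j then 1 else 0) -
      (\<Sum>k<n. complex_of_real c * (\<psi> k $ i * cnj (\<psi> k $ j)))" if "i < d" "j < d" for i j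
    using that carrier_vecD[OF \<psi>(1)] by (auto simp: mat_sum_def proj_def intro!: sum.cong)
  show "mat_adjoint (1\<^sub>m d - ?S) = 1\<^sub>m d - ?S"
  proof (rule eq_matI)
    fix i j assume "i < dim_row (1\<^sub>m d - ?S)" "j < dim_col (1\<^sub>m d - ?S)"
    then have ij: "i < d" "j < d" using carr by auto
    have "mat_adjoint (1\<^sub>m d - ?S) $$ (i, j) = cnj ((1\<^sub>m d - ?S) $$ (j, i))"
      using carr ij by (rule index_mat_adjoint)
    also have "\<dots> = (1\<^sub>m d - ?S) $$ (i, j)"
      unfolding entry[OF ij] entry[OF ij(2,1)] by (simp add: mult.commute)
    finally show "mat_adjoint (1\<^sub>m d - ?S) $$ (i, j) = (1\<^sub>m d - ?S) $$ (i, j)" .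
  qed (use mat_adjoint_carrier[OF carr] carr in auto)
  fix v :: "complex vec" assume v: "v \<in> carrier_vec d"
  have "((1\<^sub>m d - ?S) *\<^sub>v v) \<bullet>c v = v \<bullet>c v - (?S *\<^sub>v v) \<bullet>c v"
    using v minus_scalar_prod_distrib[OF v mult_mat_vec_carrier[OF mat_sum_carrier v], of "conjugate v"]
    by (simp add: minus_mult_distrib_mat_vec[of _ d d])
  also have "(?S *\<^sub>v v) \<bullet>c v = (\<Sum>k<n. complex_of_real c * ((proj (\<psi> k) *\<^sub>v v) \<bullet>c v))"
  proof -
    have "(?S *\<^sub>v v) \<bullet>c v = (\<Sum>i<d. \<Sum>j<d. \<Sum>k<n. complex_of_real c * (proj (\<psi> k) $$ (i, j) * v $ j * cnj (v $ i)))"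
    proof -
      have "?S $$ (i, j) = (\<Sum>k<n. complex_of_real c * proj (\<psi> k) $$ (i, j))" if "i < d" "j < d" for i j
        using that carrier_matD[OF proj_carrier[OF \<psi>(1)]] by (auto simp: mat_sum_def intro!: sum.cong)
      then show ?thesis
        using v by (simp add: inner_mat_mult_vec[of _ d] sum_distrib_left sum_distrib_right mult_ac)
    qed
    also have "\<dots> = (\<Sum>i<d. \<Sum>k<n. \<Sum>j<d. complex_of_real c * (proj (\<psi> k) $$ (i, j) * v $ j * cnj (v $ i)))"
      by (intro sum.cong refl sum.swap)
    also have "\<dots> = (\<Sum>k<n. \<Sum>i<d. \<Sum>j<d. complex_of_real c * (proj (\<psi> k) $$ (i, j) * v $ j * cnj (v $ i)))"
      by (rule sum.swap)
    also have "\<dots> = (\<Sum>k<n. complex_of_real c * ((proj (\<psi> k) *\<^sub>v v) \<bullet>c v))"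
      using v \<psi>(1) by (simp add: inner_mat_mult_vec[of _ d] proj_carrier sum_distrib_left)
    finally show ?thesis .
  qed
  also have "\<dots> = complex_of_real (\<Sum>k<n. c * (cmod (v \<bullet>c \<psi> k))\<^sup>2)"
    using v \<psi>(1) by (simp add: inner_proj_mult_vec[of _ d])
  finally have eq: "((1\<^sub>m d - ?S) *\<^sub>v v) \<bullet>c v =
      v \<bullet>c v - complex_of_real (\<Sum>k<n. c * (cmod (v \<bullet>c \<psi> k))\<^sup>2)" .
  have vv: "v \<bullet>c v \<ge> 0" by (rule conjugate_square_ge_0_vec)
  have "(\<Sum>k<n. c * (cmod (v \<bullet>c \<psi> k))\<^sup>2) \<le> (\<Sum>k<n. c * Re (v \<bullet>c v))"
    using Cauchy_Schwarz_complex_vec[OF v \<psi>(1)] \<psi>(2) c(1)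
    by (intro sum_mono mult_left_mono) auto
  also have "\<dots> = (real n * c) * Re (v \<bullet>c v)" by simp
  also have "\<dots> \<le> 1 * Re (v \<bullet>c v)"
    using c(2) vv by (intro mult_right_mono) (auto simp: less_eq_complex_def)
  finally show "0 \<le> ((1\<^sub>m d - ?S) *\<^sub>v v) \<bullet>c v"
    using vv unfolding eq by (simp add: less_eq_complex_def)
qed

section \<open>Construction of the discriminating POVM\<close>

lemma mat_trace_minus_mult:
  assumes "A \<in> carrier_mat d d" "B \<in> carrier_mat d d" "C \<in> carrier_mat d d"
  shows "mat_trace ((A - B) * C) = mat_trace (A * C) - mat_trace (B * C)"
proof -
  have "mat_trace ((A - B) * C) = (\<Sum>i<d. \<Sum>j<d. (A - B) $$ (i, j) * C $$ (j, i))"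
    using assms by (intro mat_trace_mult) (simp_all add: minus_carrier_mat)
  then show ?thesis
    using assms by (simp add: mat_trace_mult[of _ d d] left_diff_distrib sum_subtractf)
qed

theorem mainTheorem7:
  fixes ps :: "nat list" and n :: nat and \<psi> :: "nat \<Rightarrow> complex vec"
  assumes "ps \<noteq> []" and "\<forall>p \<in> set ps. prime p \<and> odd p"
    and "\<forall>i<n. pure_stabilizer_state ps (\<psi> i)"
    and "\<forall>i<n. \<forall>j<n. i \<noteq> j \<longrightarrow> \<psi> i \<bullet>c \<psi> j = 0"
  shows "unambiguously_distinguishable_pwf ps n (\<lambda>i. proj (\<psi> i))"
proof -
  define d where "d = prod_list ps"
  \<comment> \<open>The weight has to satisfy n c \<le> 1, both for the operator inequality and for
    the Wigner function of the inconclusive effect. The denominator n + 1 keeps it positive for n =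
    0 as well.\<close>
  define c :: real where "c = 1 / (real n + 1)"
  have c: "0 < c" "real n * c \<le> 1" by (simp_all add: c_def)
  have odd: "\<forall>p \<in> set ps. odd p" using assms(2) by blast
  have \<psi>: "\<psi> i \<in> carrier_vec d" "\<psi> i \<bullet>c \<psi> i = 1" if "i < n" for i
    using assms(3) that by (auto simp: pure_stabilizer_state_def Let_def d_def)
  define F where "F i = complex_of_real c \<cdot>\<^sub>m proj (\<psi> i)" for i
  \<comment> \<open>All indices from n on receive the inconclusive effect, so the Wigner functions
    can be treated for every index without a bound.\<close>
  define E where "E i = (if i < n then F i else 1\<^sub>m d - mat_sum d F {..<n})" for i
  have F: "F i \<in> carrier_mat d d" if "i < n" for i
    using \<psi>(1)[OF that] by (simp add: F_def proj_carrier)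
  have "psd_mat d (F i)" if "i < n" for i
    unfolding F_def using \<psi>(1)[OF that] c(1) by (intro psd_mat_smult psd_mat_proj) auto
  moreover have "psd_mat d (1\<^sub>m d - mat_sum d F {..<n})"
    unfolding F_def using \<psi> c by (intro psd_mat_one_minus_sum_proj) auto
  moreover have "mat_sum d E {..<n + 1} = 1\<^sub>m d"
    by (rule eq_matI) (auto simp: mat_sum_def E_def)
  ultimately have povm: "povm d (n + 1) E"
    by (simp add: povm_def E_def)
  have "pwf ps (E i)" for i
    unfolding pwf_def
  proof
    fix u assume u: "u \<in> phase_space ps"
    have A: "phase_point ps u \<in> carrier_mat d d"
      unfolding d_def using odd u by (rule phase_point_carrier)
    have W: "wigner ps (F k) u = complex_of_real c * wigner ps (proj (\<psi> k)) u" if "k < n" for k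
      unfolding wigner_def F_def using A \<psi>(1)[OF that] by (intro mat_trace_smult_mult) auto
    have W01: "wigner ps (proj (\<psi> k)) u \<in> {0, 1}" if "k < n" for k
      using odd assms(3) that u by (intro wigner_stabilizer_state) auto
    \<comment> \<open>The lower bound serves the conclusive effects; the upper bound, which rests on
      Wigner values at most 1, serves the inconclusive one.\<close>
    have bounds: "0 \<le> wigner ps (F k) u" "wigner ps (F k) u \<le> complex_of_real c" if "k < n" for k
      using W[OF that] W01[OF that] c(1) by (auto simp: less_eq_complex_def)
    show "0 \<le> wigner ps (E i) u"
    proof (cases "i < n")
      case True
      then show ?thesis using bounds(1) by (simp add: E_def)
    next
      case False
      \<comment> \<open>The identity has Wigner function 1 everywhere because phase-point operators
        have trace 1.\<close>
      have "wigner ps (1\<^sub>m d - mat_sum d F {..<n}) u = 1 - (\<Sum>k<n. wigner ps (F k) u)"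
        unfolding wigner_def using A F odd u mat_trace_mat_sum_mult[OF A, of "{..<n}" F]
        by (simp add: mat_trace_minus_mult[of _ d] mat_trace_phase_point)
      moreover have "(\<Sum>k<n. wigner ps (F k) u) \<le> (\<Sum>k<n. complex_of_real c)"
        using bounds(2) by (intro sum_mono) auto
      moreover have "(\<Sum>k<n. complex_of_real c) \<le> 1"
        using c(2) by (simp add: less_eq_complex_def)
      ultimately show ?thesis
        using False by (simp add: E_def)
    qed
  qed
  with povm have "pwf_povm ps (n + 1) E"
    by (simp add: pwf_povm_def d_def)
  \<comment> \<open>For distinct indices this vanishes by orthogonality; for equal ones it is c >
    0.\<close>
  moreover have tr: "mat_trace (E i * proj (\<psi> j)) = complex_of_real c * ((\<psi> i \<bullet>c \<psi> j) * (\<psi> j \<bullet>c \<psi> i))"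
    if "i < n" "j < n" for i j
    using that \<psi>(1)[OF that(1)] \<psi>(1)[OF that(2)]
    by (simp add: E_def F_def mat_trace_smult_mult[of _ d] proj_carrier mat_trace_proj_mult_proj[of _ d])
  ultimately show ?thesis
    unfolding unambiguously_distinguishable_pwf_def
    using assms(4) \<psi>(2) c(1) by (intro exI[of _ E]) (auto simp: less_complex_def)
qed

end
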